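(* Let $m\ge 0$ and $n>m+1$ be integers, and let $G$ be a graph whose vertex set has a partition into sets $V_{i,j}$, $i,j\in\{0,\ldots,n\}$, with the following properties: (1) $|V_{i,0}|\le 1$ for all $i\ge 1$; (2) $|V_{0,j}|\le 1$ for all $j\ge 1$; (3) $|V_{i,j}|\ge 1$ for all $i,j\ge 1$; (4) $G[\bigcup_{j=0}^n V_{i,j}]$ is connected for all $i\ge 1$; (5) $G[\bigcup_{i=0}^n V_{i,j}]$ is connected for all $j\ge 1$; (6) for $i,j,k\ge 1$, if a vertex of $V_{k,0}$ is adjacent to a vertex of $V_{i,j}$ then $i\le k$; (7) for $i,j,k\ge 1$, if a vertex of $V_{0,k}$ is adjacent to a vertex of $V_{i,j}$ then $j\le k$; (8) for $i,j,k,\ell\ge 1$, if a vertex of $V_{i,j}$ is adjacent to a vertex of $V_{k,\ell}$ then $|k-i|\le m$ and $|\ell-j|\le m$. Then the clique-width of $G$ is at least $\lfloor \frac{n-1}{m+1}\rfloor+1$.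
   Context: All graphs are finite, simple and undirected; $G[S]$ denotes the subgraph of $G$ induced by $S\subseteq V(G)$; sets in the partition may be empty unless stated otherwise. The clique-width of a graph $G$ is the minimum number of labels needed to construct $G$ using the operations: create a single vertex with label $i$; take the disjoint union of two labelled graphs; add all edges between vertices labelled $i$ and vertices labelled $j$ ($i\neq j$); rename label $i$ to $j$. *)

theory Defs
  imports Complex_Main "HOL-Library.Disjoint_Sets" "Graph_Theory.Graph_Theory"
begin

text \<open>
  A finite simple undirected graph is a \<^locale>\<open>pair_graph\<close>: an undirected edge
  \<open>uv\<close> is represented by the two arcs \<open>(u, v)\<close> and \<open>(v, u)\<close>.

  \<open>cw_construction k G lab\<close> says that the graph \<open>G\<close>, with label \<open>lab v\<close> on every vertex \<open>v\<close>,
  can be constructed with the \<open>k\<close> labels \<open>0, \<dots>, k - 1\<close>. The values of \<open>lab\<close> outside of the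
  vertex set of \<open>G\<close> play no role.
\<close>

inductive cw_construction :: "nat \<Rightarrow> 'a pair_pre_digraph \<Rightarrow> ('a \<Rightarrow> nat) \<Rightarrow> bool" for k :: nat where
  single_vertex:
    "i < k \<Longrightarrow> cw_construction k \<lparr>pverts = {v}, parcs = {}\<rparr> (\<lambda>_. i)"
| disjoint_union:
    "cw_construction k G lab \<Longrightarrow> cw_construction k H lab' \<Longrightarrow> pverts G \<inter> pverts H = {} \<Longrightarrow>
     cw_construction k \<lparr>pverts = pverts G \<union> pverts H, parcs = parcs G \<union> parcs H\<rparr>
       (\<lambda>v. if v \<in> pverts G then lab v else lab' v)"
| add_edges:
    "cw_construction k G lab \<Longrightarrow> i < k \<Longrightarrow> j < k \<Longrightarrow> i \<noteq> j \<Longrightarrow>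
     cw_construction k
       \<lparr>pverts = pverts G,
        parcs = parcs G \<union> {(u, v). u \<in> pverts G \<and> v \<in> pverts G \<and>
                   (lab u = i \<and> lab v = j \<or> lab u = j \<and> lab v = i)}\<rparr>
       lab"
| rename_label:
    "cw_construction k G lab \<Longrightarrow> i < k \<Longrightarrow> j < k \<Longrightarrow>
     cw_construction k G (\<lambda>v. if lab v = i then j else lab v)"

definition clique_width :: "'a pair_pre_digraph \<Rightarrow> nat" where
  "clique_width G = (LEAST k. \<exists>lab. cw_construction k G lab)"

text \<open>
  The minimum is attained for every graph with at least one vertex: take one label per vertex.
\<close>

lemma cw_construction_edgeless:
  assumes "finite V" "V \<noteq> {}" "\<forall>v\<in>V. f v < k"
  shows "\<exists>lab. cw_construction k \<lparr>pverts = V, parcs = {}\<rparr> lab \<and> (\<forall>v\<in>V. lab v = f v)"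
  using assms
proof (induction V rule: finite_ne_induct)
  case (singleton x)
  then show ?case using single_vertex[of "f x" k x] by auto
next
  case (insert x F)
  then obtain lab where lab: "cw_construction k \<lparr>pverts = F, parcs = {}\<rparr> lab" "\<forall>v\<in>F. lab v = f v"
    by auto
  from insert have "f x < k" by simp
  from disjoint_union[OF single_vertex[OF this, of x] lab(1)] insert(3)
  have "cw_construction k \<lparr>pverts = insert x F, parcs = {}\<rparr> (\<lambda>v. if v \<in> {x} then f x else lab v)"
    by simp
  with lab(2) show ?case by (intro exI conjI) auto
qed

lemma cw_construction_edges:
  assumes lab: "cw_construction k \<lparr>pverts = V, parcs = {}\<rparr> lab" "inj_on lab V" "\<forall>v\<in>V. lab v < k"
    and "finite F" "\<forall>(u, v)\<in>F. u \<in> V \<and> v \<in> V \<and> u \<noteq> v"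
  shows "cw_construction k \<lparr>pverts = V, parcs = F \<union> F\<inverse>\<rparr> lab"
  using assms(4,5)
proof (induction F rule: finite_induct)
  case empty
  then show ?case using lab by simp
next
  case (insert e F)
  obtain u v where e: "e = (u, v)" by force
  with insert have uv: "u \<in> V" "v \<in> V" "u \<noteq> v" by auto
  have IH: "cw_construction k \<lparr>pverts = V, parcs = F \<union> F\<inverse>\<rparr> lab" using insert by auto
  have ne: "lab u \<noteq> lab v" using uv lab(2) by (auto dest: inj_onD)
  have "{(a, b). a \<in> V \<and> b \<in> V \<and> (lab a = lab u \<and> lab b = lab v \<or> lab a = lab v \<and> lab b = lab u)}
      = {(u, v), (v, u)}"
    using uv lab(2) by (auto dest: inj_onD)
  then have "cw_construction k \<lparr>pverts = V, parcs = (F \<union> F\<inverse>) \<union> {(u, v), (v, u)}\<rparr> lab"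
    using add_edges[OF IH, of "lab u" "lab v"] ne uv lab(3) by simp
  moreover have "(F \<union> F\<inverse>) \<union> {(u, v), (v, u)} = insert e F \<union> (insert e F)\<inverse>"
    by (auto simp: e)
  ultimately show ?case by simp
qed

lemma ex_cw_construction:
  assumes "pair_graph G" "pverts G \<noteq> {}"
  shows "\<exists>k lab. cw_construction k G lab"
proof -
  interpret pair_graph G by fact
  obtain f :: "'a \<Rightarrow> nat" and k where f: "f ` pverts G = {i. i < k}" "inj_on f (pverts G)"
    using finite_imp_inj_to_nat_seg[OF pair_finite_verts] by blast
  have "\<forall>v\<in>pverts G. f v < k" using f(1) by auto
  then obtain lab where lab: "cw_construction k \<lparr>pverts = pverts G, parcs = {}\<rparr> lab"
      "\<forall>v\<in>pverts G. lab v = f v"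
    using cw_construction_edgeless[OF pair_finite_verts assms(2)] by blast
  have "cw_construction k \<lparr>pverts = pverts G, parcs = parcs G \<union> (parcs G)\<inverse>\<rparr> lab"
  proof (rule cw_construction_edges[OF lab(1)])
    show "inj_on lab (pverts G)" using f(2) lab(2) by (auto simp: inj_on_def)
    show "\<forall>v\<in>pverts G. lab v < k" using \<open>\<forall>v\<in>pverts G. f v < k\<close> lab(2) by auto
    show "finite (parcs G)" by (rule pair_finite_arcs)
    show "\<forall>(u, v)\<in>parcs G. u \<in> pverts G \<and> v \<in> pverts G \<and> u \<noteq> v"
      by (auto dest: in_arcsD1 in_arcsD2 no_loops')
  qed
  moreover have "(parcs G)\<inverse> = parcs G"
    using pair_sym_arcs by (auto simp: symmetric_def sym_def)
  moreover have "\<lparr>pverts = pverts G, parcs = parcs G\<rparr> = G" by simp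
  ultimately show ?thesis by (metis sup.idem)
qed

lemma cw_construction_clique_width:
  assumes "pair_graph G" "pverts G \<noteq> {}"
  shows "\<exists>lab. cw_construction (clique_width G) G lab"
  unfolding clique_width_def using ex_cw_construction[OF assms] by (rule LeastI_ex)

end

theory Submission
  imports Defs
begin

text \<open>
  In a construction of \<open>G\<close> with \<open>k\<close> labels, consider the first time that the graph built so far
  contains a full row or column (\<open>i\<close>-th row: \<open>\<Union>j. V i j\<close>, \<open>j\<close>-th column: \<open>\<Union>i. V i j\<close>, with
  \<open>i, j \<ge> 1\<close>). It is then the disjoint union of two graphs with vertex sets \<open>A\<close> and \<open>B\<close>, neither of
  which contains a full row or column. If \<open>A \<union> B\<close> contains a row, it meets every column, so by
  connectivity every column \<open>j\<close> has an edge \<open>x j\<close>--\<open>y j\<close> of \<open>G\<close> with \<open>x j \<in> A \<union> B\<close> that is not yet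
  present. If \<open>x j\<close> and \<open>x j'\<close> have the same label, then \<open>y j\<close>--\<open>x j'\<close> and \<open>y j'\<close>--\<open>x j\<close> are edges
  of \<open>G\<close> as well, which the hypotheses exclude when \<open>j + m < j'\<close>. So the columns
  \<open>1, 1 + (m + 1), 1 + 2 (m + 1), \<dots>\<close> use different labels.
\<close>

section \<open>Constructions and the union at which a vertex-set property first appears\<close>

lemma cw_construction_parcs:
  assumes "cw_construction k G lab" "(u, v) \<in> parcs G"
  shows "u \<in> pverts G \<and> v \<in> pverts G"
  using assms by (induction rule: cw_construction.induct) auto

lemma cw_construction_lab_less:
  assumes "cw_construction k G lab" "v \<in> pverts G"
  shows "lab v < k"
  using assms by (induction rule: cw_construction.induct) auto

text \<open>
  The last conjunct only matters for the induction: labels that have become equal stay equal.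
\<close>

lemma cw_construction_first_union:
  assumes "cw_construction k G lab"
    and "P (pverts G)" "\<And>v. \<not> P {v}"
  shows "\<exists>A B l. A \<inter> B = {} \<and> A \<union> B \<subseteq> pverts G \<and> P (A \<union> B) \<and> \<not> P A \<and> \<not> P B \<and>
    (\<forall>x\<in>A \<union> B. l x < k) \<and>
    (\<forall>x\<in>A \<union> B. \<forall>x'\<in>A \<union> B. \<forall>y. l x = l x' \<and> (x, y) \<in> parcs G \<and>
       \<not> {x, y} \<subseteq> A \<and> \<not> {x, y} \<subseteq> B \<longrightarrow> (x', y) \<in> parcs G) \<and>
    (\<forall>x\<in>A \<union> B. \<forall>x'\<in>A \<union> B. l x = l x' \<longrightarrow> lab x = lab x')"
  using assms
proof (induction rule: cw_construction.induct)
  case (single_vertex i v)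
  then show ?case by simp
next
  case (disjoint_union G lab H lab')
  note G = cw_construction_parcs[OF disjoint_union.hyps(1)]
  note H = cw_construction_parcs[OF disjoint_union.hyps(2)]
  \<comment> \<open>If an operand already satisfies \<open>P\<close>, the sets \<open>A\<close> and
    \<open>B\<close> found in its construction are kept; otherwise the present union is the one
    sought.\<close>
  consider "P (pverts G)" | "P (pverts H)" | "\<not> P (pverts G)" "\<not> P (pverts H)" by blast
  then show ?case
  proof cases
    case 1
    from disjoint_union.IH(1)[OF 1 disjoint_union.prems(2)] obtain A B l where
      *: "A \<inter> B = {}" "A \<union> B \<subseteq> pverts G" "P (A \<union> B)" "\<not> P A" "\<not> P B" "\<forall>x\<in>A \<union> B. l x < k"
        "\<forall>x\<in>A \<union> B. \<forall>x'\<in>A \<union> B. \<forall>y. l x = l x' \<and> (x, y) \<in> parcs G \<and>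
           \<not> {x, y} \<subseteq> A \<and> \<not> {x, y} \<subseteq> B \<longrightarrow> (x', y) \<in> parcs G"
        "\<forall>x\<in>A \<union> B. \<forall>x'\<in>A \<union> B. l x = l x' \<longrightarrow> lab x = lab x'"
      by (elim exE conjE) (rule that)
    \<comment> \<open>The operands have disjoint vertex sets, so no arc of \<open>H\<close> starts
      in \<open>A \<union> B\<close>, and the condition on vertices with equal \<open>l\<close>
      carries over from \<open>G\<close>.\<close>
    have arc: "(x, y) \<in> parcs G" if "x \<in> A \<union> B" "(x, y) \<in> parcs G \<union> parcs H" for x y
      using that *(2) H disjoint_union.hyps(3) by blast
    have "\<forall>x\<in>A \<union> B. \<forall>x'\<in>A \<union> B. \<forall>y. l x = l x' \<and> (x, y) \<in> parcs G \<union> parcs H \<and>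
        \<not> {x, y} \<subseteq> A \<and> \<not> {x, y} \<subseteq> B \<longrightarrow> (x', y) \<in> parcs G \<union> parcs H"
      using *(7) arc by blast
    moreover have l: "(if x \<in> pverts G then lab x else lab' x) = lab x" if "x \<in> A \<union> B" for x
      using that *(2) disjoint_union.hyps(3) by auto
    have "\<forall>x\<in>A \<union> B. \<forall>x'\<in>A \<union> B. l x = l x' \<longrightarrow>
        (if x \<in> pverts G then lab x else lab' x) = (if x' \<in> pverts G then lab x' else lab' x')"
      by (intro ballI impI) (subst (1 2) l, assumption, assumption, rule *(8)[rule_format])
    moreover have "A \<union> B \<subseteq> pverts G \<union> pverts H" using *(2) by blast
    ultimately show ?thesis using *(1,3-6)
      by - (rule exI[of _ A], rule exI[of _ B], rule exI[of _ l], unfold pair_pre_digraph.simps,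
          intro conjI)
  next
    case 2
    from disjoint_union.IH(2)[OF 2 disjoint_union.prems(2)] obtain A B l where
      *: "A \<inter> B = {}" "A \<union> B \<subseteq> pverts H" "P (A \<union> B)" "\<not> P A" "\<not> P B" "\<forall>x\<in>A \<union> B. l x < k"
        "\<forall>x\<in>A \<union> B. \<forall>x'\<in>A \<union> B. \<forall>y. l x = l x' \<and> (x, y) \<in> parcs H \<and>
           \<not> {x, y} \<subseteq> A \<and> \<not> {x, y} \<subseteq> B \<longrightarrow> (x', y) \<in> parcs H"
        "\<forall>x\<in>A \<union> B. \<forall>x'\<in>A \<union> B. l x = l x' \<longrightarrow> lab' x = lab' x'"
      by (elim exE conjE) (rule that)
    have arc: "(x, y) \<in> parcs H" if "x \<in> A \<union> B" "(x, y) \<in> parcs G \<union> parcs H" for x y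
      using that *(2) G disjoint_union.hyps(3) by blast
    have "\<forall>x\<in>A \<union> B. \<forall>x'\<in>A \<union> B. \<forall>y. l x = l x' \<and> (x, y) \<in> parcs G \<union> parcs H \<and>
        \<not> {x, y} \<subseteq> A \<and> \<not> {x, y} \<subseteq> B \<longrightarrow> (x', y) \<in> parcs G \<union> parcs H"
      using *(7) arc by blast
    moreover have l: "(if x \<in> pverts G then lab x else lab' x) = lab' x" if "x \<in> A \<union> B" for x
      using that *(2) disjoint_union.hyps(3) by auto
    have "\<forall>x\<in>A \<union> B. \<forall>x'\<in>A \<union> B. l x = l x' \<longrightarrow>
        (if x \<in> pverts G then lab x else lab' x) = (if x' \<in> pverts G then lab x' else lab' x')"
      by (intro ballI impI) (subst (1 2) l, assumption, assumption, rule *(8)[rule_format])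
    moreover have "A \<union> B \<subseteq> pverts G \<union> pverts H" using *(2) by blast
    ultimately show ?thesis using *(1,3-6)
      by - (rule exI[of _ A], rule exI[of _ B], rule exI[of _ l], unfold pair_pre_digraph.simps,
          intro conjI)
  next
    case 3
    let ?l = "\<lambda>v. if v \<in> pverts G then lab v else lab' v"
    \<comment> \<open>Every arc present at this moment lies inside one operand, so the condition on
      crossing arcs holds vacuously.\<close>
    have "{x, y} \<subseteq> pverts G \<or> {x, y} \<subseteq> pverts H" if "(x, y) \<in> parcs G \<union> parcs H" for x y
      using that G H by blast
    moreover have "?l v < k" if "v \<in> pverts G \<union> pverts H" for v
      using that cw_construction_lab_less disjoint_union.hyps(1,2) by auto
    ultimately show ?thesis
      using 3 disjoint_union.hyps(3) disjoint_union.prems(1)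
      by - (rule exI[of _ "pverts G"], rule exI[of _ "pverts H"], rule exI[of _ ?l],
          intro conjI, auto)
  qed
next
  case (add_edges G lab i j)
  let ?E = "{(u, v). u \<in> pverts G \<and> v \<in> pverts G \<and>
    (lab u = i \<and> lab v = j \<or> lab u = j \<and> lab v = i)}"
  from add_edges.prems have "P (pverts G)" by simp
  from add_edges.IH[OF this add_edges.prems(2)] obtain A B l where
    *: "A \<inter> B = {}" "A \<union> B \<subseteq> pverts G" "P (A \<union> B)" "\<not> P A" "\<not> P B" "\<forall>x\<in>A \<union> B. l x < k"
      "\<forall>x\<in>A \<union> B. \<forall>x'\<in>A \<union> B. \<forall>y. l x = l x' \<and> (x, y) \<in> parcs G \<and>
         \<not> {x, y} \<subseteq> A \<and> \<not> {x, y} \<subseteq> B \<longrightarrow> (x', y) \<in> parcs G"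
      "\<forall>x\<in>A \<union> B. \<forall>x'\<in>A \<union> B. l x = l x' \<longrightarrow> lab x = lab x'"
    by (elim exE conjE) (rule that)
  \<comment> \<open>Equal \<open>l\<close> forces equal current labels, so the new edges treat
    \<open>x\<close> and \<open>x'\<close> alike.\<close>
  have "(x', y) \<in> ?E" if "x \<in> A \<union> B" "x' \<in> A \<union> B" "l x = l x'" "(x, y) \<in> ?E" for x x' y
  proof -
    have "lab x = lab x'" using *(8) that(1-3) by blast
    with that(2,4) *(2) show ?thesis by auto
  qed
  with *(7) have "\<forall>x\<in>A \<union> B. \<forall>x'\<in>A \<union> B. \<forall>y. l x = l x' \<and> (x, y) \<in> parcs G \<union> ?E \<and>
      \<not> {x, y} \<subseteq> A \<and> \<not> {x, y} \<subseteq> B \<longrightarrow> (x', y) \<in> parcs G \<union> ?E"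
    by blast
  with *(1-6,8) show ?case
    by - (rule exI[of _ A], rule exI[of _ B], rule exI[of _ l], unfold pair_pre_digraph.simps,
        intro conjI)
next
  case (rename_label G lab i j)
  from rename_label.IH[OF rename_label.prems] obtain A B l where
    *: "A \<inter> B = {}" "A \<union> B \<subseteq> pverts G" "P (A \<union> B)" "\<not> P A" "\<not> P B" "\<forall>x\<in>A \<union> B. l x < k"
      "\<forall>x\<in>A \<union> B. \<forall>x'\<in>A \<union> B. \<forall>y. l x = l x' \<and> (x, y) \<in> parcs G \<and>
         \<not> {x, y} \<subseteq> A \<and> \<not> {x, y} \<subseteq> B \<longrightarrow> (x', y) \<in> parcs G"
      "\<forall>x\<in>A \<union> B. \<forall>x'\<in>A \<union> B. l x = l x' \<longrightarrow> lab x = lab x'"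
    by (elim exE conjE) (rule that)
  from *(8) have "\<forall>x\<in>A \<union> B. \<forall>x'\<in>A \<union> B. l x = l x' \<longrightarrow>
      (if lab x = i then j else lab x) = (if lab x' = i then j else lab x')"
    by metis
  with *(1-7) show ?case
    by - (rule exI[of _ A], rule exI[of _ B], rule exI[of _ l], intro conjI)
qed

section \<open>Crossing edges and the count of labels\<close>

text \<open>A path inside \<open>C\<close> leads from \<open>z\<close> to a vertex outside
  \<open>A\<close>; its first step out of \<open>A\<close> is the required arc.\<close>

lemma connected_crossing_arc:
  assumes "pair_graph G" and C: "Digraph_Component.connected (with_proj G \<restriction> C)"
    and "z \<in> C" "z \<in> A" "\<not> C \<subseteq> A"
  shows "\<exists>x y. x \<in> C \<and> y \<in> C \<and> x \<in> A \<and> y \<notin> A \<and> (x, y) \<in> parcs G"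
proof -
  interpret pair_graph G by fact
  obtain w where w: "w \<in> C" "w \<notin> A" using assms(5) by blast
  have "(z, w) \<in> rtrancl_on C ((arcs_ends (with_proj G \<restriction> C))\<^sup>s)"
    using C w(1) assms(3) by (auto simp: connected_conv)
  then have "w \<in> A \<or> ?thesis"
  proof (induction rule: rtrancl_on_induct)
    case base
    then show ?case using assms(4) by simp
  next
    case (step u v)
    \<comment> \<open>Connectivity refers to the symmetric closure, so a step may run against an
      arc; the symmetry of \<open>G\<close> supplies the reverse one.\<close>
    have "(u, v) \<in> parcs G \<and> u \<in> C \<and> v \<in> C"
      using step.hyps arcs_symmetric
      by (auto simp: symcl_def arcs_ends_conv)
    then show ?case using step.IH by blast
  qed
  with w(2) show ?thesis by blast
qed

text \<open>Stated for an arbitrary family \<open>W\<close>, so that the transposed partition yields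
  the same bound for rows. \<open>W 0 j\<close> is the border cell of column
  \<open>j\<close>.\<close>

lemma columns_need_labels:
  fixes m n k :: nat and W :: "nat \<Rightarrow> nat \<Rightarrow> 'a set"
  assumes "pair_graph G" and "n \<ge> 1"
    and fin: "\<forall>j\<in>{1..n}. finite (W 0 j)"
    and single: "\<forall>j\<in>{1..n}. card (W 0 j) \<le> 1"
    and conn: "\<forall>j\<in>{1..n}. Digraph_Component.connected (with_proj G \<restriction> (\<Union>i\<in>{0..n}. W i j))"
    and border: "\<forall>i\<in>{1..n}. \<forall>j\<in>{1..n}. \<forall>k\<in>{1..n}.
           (\<exists>u\<in>W 0 k. \<exists>v\<in>W i j. (u, v) \<in> parcs G) \<longrightarrow> j \<le> k"
    and inner: "\<forall>i\<in>{1..n}. \<forall>j\<in>{1..n}. \<forall>k\<in>{1..n}. \<forall>l\<in>{1..n}.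
           (\<exists>u\<in>W i j. \<exists>v\<in>W k l. (u, v) \<in> parcs G) \<longrightarrow> \<bar>int l - int j\<bar> \<le> int m"
    and disj: "A \<inter> B = {}"
    and meets: "\<forall>j\<in>{1..n}. (\<Union>i\<in>{0..n}. W i j) \<inter> (A \<union> B) \<noteq> {}"
    and notsub: "\<forall>j\<in>{1..n}. \<not> (\<Union>i\<in>{0..n}. W i j) \<subseteq> A \<and> \<not> (\<Union>i\<in>{0..n}. W i j) \<subseteq> B"
    and lab: "\<forall>x\<in>A \<union> B. l x < k"
    and twins: "\<forall>x\<in>A \<union> B. \<forall>x'\<in>A \<union> B. \<forall>y. l x = l x' \<and> (x, y) \<in> parcs G \<and>
       \<not> {x, y} \<subseteq> A \<and> \<not> {x, y} \<subseteq> B \<longrightarrow> (x', y) \<in> parcs G"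
  shows "(n - 1) div (m + 1) + 1 \<le> k"
proof -
  interpret pair_graph G by fact
  have "\<exists>x y. x \<in> (\<Union>i\<in>{0..n}. W i j) \<and> y \<in> (\<Union>i\<in>{0..n}. W i j) \<and> x \<in> A \<union> B \<and>
      (x, y) \<in> parcs G \<and> \<not> {x, y} \<subseteq> A \<and> \<not> {x, y} \<subseteq> B" if j: "j \<in> {1..n}" for j
  proof -
    let ?C = "\<Union>i\<in>{0..n}. W i j"
    obtain z where z: "z \<in> ?C" "z \<in> A \<union> B" using meets j by blast
    \<comment> \<open>\<open>S\<close> is the side containing \<open>z\<close>. Since the sides are
      disjoint, an arc leaving \<open>S\<close> lies within neither of them.\<close>
    obtain S where S: "S = A \<or> S = B" "z \<in> S" using z(2) by blast
    have ns: "\<not> ?C \<subseteq> S" using S(1) notsub j by blast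
    obtain x y where "x \<in> ?C" "y \<in> ?C" "x \<in> S" "y \<notin> S" "(x, y) \<in> parcs G"
      using connected_crossing_arc[OF \<open>pair_graph G\<close> bspec[OF conn j] z(1) S(2) ns] by blast
    then show ?thesis using S(1) disj by blast
  qed
  then obtain x y where xy: "\<And>j. j \<in> {1..n} \<Longrightarrow> x j \<in> (\<Union>i\<in>{0..n}. W i j)"
      "\<And>j. j \<in> {1..n} \<Longrightarrow> y j \<in> (\<Union>i\<in>{0..n}. W i j)" "\<And>j. j \<in> {1..n} \<Longrightarrow> x j \<in> A \<union> B"
      "\<And>j. j \<in> {1..n} \<Longrightarrow> (x j, y j) \<in> parcs G"
      "\<And>j. j \<in> {1..n} \<Longrightarrow> \<not> {x j, y j} \<subseteq> A \<and> \<not> {x j, y j} \<subseteq> B"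
    by metis
  \<comment> \<open>An edge between columns more than \<open>m\<close> apart ends in the border cell
    of the larger one: for an interior \<open>v\<close>, \<open>border\<close> excludes a border
    vertex \<open>u\<close> and \<open>inner\<close> excludes an interior \<open>u\<close>.\<close>
  have far: "v \<in> W 0 j'" if e: "(u, v) \<in> parcs G" and j: "j \<in> {1..n}" "j' \<in> {1..n}" "j + m < j'"
      and u: "u \<in> (\<Union>i\<in>{0..n}. W i j)" and v: "v \<in> (\<Union>i\<in>{0..n}. W i j')" for u v j j'
  proof (rule ccontr)
    assume "v \<notin> W 0 j'"
    then obtain b where b: "b \<in> {1..n}" "v \<in> W b j'"
      using v by (auto simp: Suc_le_eq) (metis gr0I)
    obtain a where a: "a \<le> n" "u \<in> W a j" using u by auto
    show False
    proof (cases "a = 0")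
      case True
      then have "j' \<le> j" using border b j(1,2) a(2) e by blast
      then show False using j(3) by simp
    next
      case False
      then have "a \<in> {1..n}" using a(1) by simp
      then have "\<bar>int j' - int j\<bar> \<le> int m" using inner b j(1,2) a(2) e by blast
      then show False using j(3) by simp
    qed
  qed
  \<comment> \<open>Exchanging the ends of equally labelled crossing edges puts both
    \<open>x j'\<close> and \<open>y j'\<close> into \<open>W 0 j'\<close>, which has at most one
    element; their edge would be a loop.\<close>
  have ne: "l (x j) \<noteq> l (x j')" if j: "j \<in> {1..n}" "j' \<in> {1..n}" "j + m < j'" for j j'
  proof
    assume eq: "l (x j) = l (x j')"
    have "(x j', y j) \<in> parcs G"
      using twins xy(3)[OF j(1)] xy(3)[OF j(2)] eq xy(4,5)[OF j(1)] by blast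
    then have "(y j, x j') \<in> parcs G" by (rule arcs_symmetric)
    then have x: "x j' \<in> W 0 j'" by (rule far[OF _ j xy(2)[OF j(1)] xy(1)[OF j(2)]])
    have "(x j, y j') \<in> parcs G"
      using twins xy(3)[OF j(1)] xy(3)[OF j(2)] eq[symmetric] xy(4,5)[OF j(2)] by blast
    then have y: "y j' \<in> W 0 j'" by (rule far[OF _ j xy(1)[OF j(1)] xy(2)[OF j(2)]])
    have "x j' = y j'"
      using x y fin single j(2) by (metis card_le_Suc0_iff_eq One_nat_def)
    then show False using xy(4)[OF j(2)] no_loops' by blast
  qed
  let ?q = "(n - 1) div (m + 1)"
  \<comment> \<open>Successive columns \<open>c t\<close> are \<open>m + 1\<close> apart, just
    beyond the reach \<open>m\<close>, and \<open>?q\<close> is the largest \<open>t\<close> with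
    \<open>c t \<le> n\<close>.\<close>
  define c where "c t = 1 + t * (m + 1)" for t
  have c: "c t \<in> {1..n}" if "t \<le> ?q" for t
  proof -
    have "t * (m + 1) \<le> ?q * (m + 1)" using that by (rule mult_le_mono1)
    also have "\<dots> \<le> n - 1" by (rule div_times_less_eq_dividend)
    finally show ?thesis using assms(2) unfolding c_def by simp
  qed
  have clt: "c s + m < c t" if "s < t" for s t
  proof -
    have "Suc s * (m + 1) \<le> t * (m + 1)" using that by (intro mult_le_mono1) simp
    then show ?thesis unfolding c_def by simp
  qed
  have "inj_on (\<lambda>t. l (x (c t))) {..?q}"
  proof (rule linorder_inj_onI)
    fix s t assume "s < t" "s \<in> {..?q}" "t \<in> {..?q}"
    then show "l (x (c s)) \<noteq> l (x (c t))" using ne c clt by simp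
  qed auto
  moreover have "(\<lambda>t. l (x (c t))) ` {..?q} \<subseteq> {..<k}"
    using lab xy(3) c by blast
  ultimately have "card {..?q} \<le> card {..<k}" by (intro card_inj_on_le) auto
  then show ?thesis by simp
qed

section \<open>The bound for the partitioned graph\<close>

theorem theorem3:
  fixes m n :: nat
    and G :: "'a pair_pre_digraph"
    and V :: "nat \<Rightarrow> nat \<Rightarrow> 'a set"
  assumes "n > m + 1"
    and "pair_graph G"
    and "(\<Union>i\<in>{0..n}. \<Union>j\<in>{0..n}. V i j) = pverts G"
    and "disjoint_family_on (\<lambda>(i, j). V i j) ({0..n} \<times> {0..n})"
    and "\<forall>i\<in>{1..n}. card (V i 0) \<le> 1"
    and "\<forall>j\<in>{1..n}. card (V 0 j) \<le> 1"
    and "\<forall>i\<in>{1..n}. \<forall>j\<in>{1..n}. card (V i j) \<ge> 1"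
    and "\<forall>i\<in>{1..n}. Digraph_Component.connected (with_proj G \<restriction> (\<Union>j\<in>{0..n}. V i j))"
    and "\<forall>j\<in>{1..n}. Digraph_Component.connected (with_proj G \<restriction> (\<Union>i\<in>{0..n}. V i j))"
    and "\<forall>i\<in>{1..n}. \<forall>j\<in>{1..n}. \<forall>k\<in>{1..n}.
           (\<exists>u\<in>V k 0. \<exists>v\<in>V i j. u \<rightarrow>\<^bsub>with_proj G\<^esub> v) \<longrightarrow> i \<le> k"
    and "\<forall>i\<in>{1..n}. \<forall>j\<in>{1..n}. \<forall>k\<in>{1..n}.
           (\<exists>u\<in>V 0 k. \<exists>v\<in>V i j. u \<rightarrow>\<^bsub>with_proj G\<^esub> v) \<longrightarrow> j \<le> k"
    and "\<forall>i\<in>{1..n}. \<forall>j\<in>{1..n}. \<forall>k\<in>{1..n}. \<forall>l\<in>{1..n}.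
           (\<exists>u\<in>V i j. \<exists>v\<in>V k l. u \<rightarrow>\<^bsub>with_proj G\<^esub> v) \<longrightarrow>
             \<bar>int k - int i\<bar> \<le> int m \<and> \<bar>int l - int j\<bar> \<le> int m"
  shows "int (clique_width G) \<ge> \<lfloor>(real n - 1) / (real m + 1)\<rfloor> + 1"
proof -
  interpret pair_graph G by fact
  have n: "n \<ge> 2" and n1: "n \<ge> 1" using assms(1) by simp_all
  have fin: "finite (V i j)" if "i \<le> n" "j \<le> n" for i j
    by (rule finite_subset[OF _ pair_finite_verts]) (use assms(3) that in auto)
  have ne: "V i j \<noteq> {}" if "i \<in> {1..n}" "j \<in> {1..n}" for i j
    using assms(7) that by fastforce
  have disj: "V i j \<inter> V i' j' = {}" if "(i, j) \<noteq> (i', j')" "i \<le> n" "j \<le> n" "i' \<le> n" "j' \<le> n"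
    for i j i' j'
    using disjoint_family_onD[OF assms(4), of "(i, j)" "(i', j')"] that by simp
  define row where "row i = (\<Union>j\<in>{0..n}. V i j)" for i
  define col where "col j = (\<Union>i\<in>{0..n}. V i j)" for j
  \<comment> \<open>Indices start at 1, since row 0 and column 0 need not be connected; every row
    and column considered still includes its border cell.\<close>
  define P where "P S \<longleftrightarrow> (\<exists>i\<in>{1..n}. row i \<subseteq> S \<or> col i \<subseteq> S)" for S
  have "row 1 \<subseteq> pverts G" unfolding row_def using assms(3) n by fastforce
  then have PG: "P (pverts G)" unfolding P_def using n by force
  \<comment> \<open>As \<open>n \<ge> 2\<close>, each row and each column has two disjoint nonempty
    cells, too many for one vertex.\<close>
  have Psing: "\<not> P {v}" for v
  proof
    assume "P {v}"
    then obtain i where i: "i \<in> {1..n}" "row i \<subseteq> {v} \<or> col i \<subseteq> {v}" unfolding P_def by blast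
    have "V i 1 \<union> V i 2 \<subseteq> row i" "V 1 i \<union> V 2 i \<subseteq> col i"
      unfolding row_def col_def using n by fastforce+
    moreover have "V i 1 \<noteq> {}" "V i 2 \<noteq> {}" "V 1 i \<noteq> {}" "V 2 i \<noteq> {}" using ne i(1) n by simp_all
    moreover have "V i 1 \<inter> V i 2 = {}" "V 1 i \<inter> V 2 i = {}" using disj i(1) n by simp_all
    ultimately show False using i(2) by blast
  qed
  have "pverts G \<noteq> {}" using \<open>row 1 \<subseteq> pverts G\<close> ne[of 1 1] n unfolding row_def by force
  then obtain lab where "cw_construction (clique_width G) G lab"
    using cw_construction_clique_width[OF assms(2)] by blast
  from cw_construction_first_union[of _ _ _ P, OF this PG Psing] obtain A B l where
    *: "A \<inter> B = {}" "P (A \<union> B)" "\<not> P A" "\<not> P B" "\<forall>x\<in>A \<union> B. l x < clique_width G"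
      "\<forall>x\<in>A \<union> B. \<forall>x'\<in>A \<union> B. \<forall>y. l x = l x' \<and> (x, y) \<in> parcs G \<and>
         \<not> {x, y} \<subseteq> A \<and> \<not> {x, y} \<subseteq> B \<longrightarrow> (x', y) \<in> parcs G"
    by (elim exE conjE) (rule that)
  have cross: "V i j \<subseteq> row i" "V i j \<subseteq> col j" if "i \<in> {1..n}" "j \<in> {1..n}" for i j
    unfolding row_def col_def using that by fastforce+
  have "(n - 1) div (m + 1) + 1 \<le> clique_width G"
  \<comment> \<open>A full row meets every column because interior cells are nonempty, so the
    columns supply the labels; a full column does the same for rows.\<close>
  proof (cases "\<exists>i\<in>{1..n}. row i \<subseteq> A \<union> B")
    case True
    then obtain i where i: "i \<in> {1..n}" "row i \<subseteq> A \<union> B" by blast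
    have "col j \<inter> (A \<union> B) \<noteq> {}" if "j \<in> {1..n}" for j
      using cross[OF i(1) that] ne[OF i(1) that] i(2) by blast
    then have meets: "\<forall>j\<in>{1..n}. (\<Union>i\<in>{0..n}. V i j) \<inter> (A \<union> B) \<noteq> {}"
      unfolding col_def by blast
    have notsub: "\<forall>j\<in>{1..n}. \<not> (\<Union>i\<in>{0..n}. V i j) \<subseteq> A \<and> \<not> (\<Union>i\<in>{0..n}. V i j) \<subseteq> B"
      using *(3,4) unfolding P_def col_def by blast
    have fin0: "\<forall>j\<in>{1..n}. finite (V 0 j)" using fin by simp
    have border: "\<forall>i\<in>{1..n}. \<forall>j\<in>{1..n}. \<forall>k\<in>{1..n}.
        (\<exists>u\<in>V 0 k. \<exists>v\<in>V i j. (u, v) \<in> parcs G) \<longrightarrow> j \<le> k"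
      using assms(11) unfolding with_proj_simps(3) .
    have inner: "\<forall>i\<in>{1..n}. \<forall>j\<in>{1..n}. \<forall>k\<in>{1..n}. \<forall>l\<in>{1..n}.
        (\<exists>u\<in>V i j. \<exists>v\<in>V k l. (u, v) \<in> parcs G) \<longrightarrow> \<bar>int l - int j\<bar> \<le> int m"
      using assms(12) unfolding with_proj_simps(3) by meson
    show ?thesis
      by (rule columns_need_labels[OF assms(2) n1 fin0 assms(6,9) border
            inner *(1) meets notsub *(5,6)])
  next
    case False
    then obtain j where j: "j \<in> {1..n}" "col j \<subseteq> A \<union> B" using *(2) unfolding P_def by blast
    have "row i \<inter> (A \<union> B) \<noteq> {}" if "i \<in> {1..n}" for i
      using cross[OF that j(1)] ne[OF that j(1)] j(2) by blast
    then have meets: "\<forall>i\<in>{1..n}. (\<Union>j\<in>{0..n}. V i j) \<inter> (A \<union> B) \<noteq> {}"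
      unfolding row_def by blast
    have notsub: "\<forall>i\<in>{1..n}. \<not> (\<Union>j\<in>{0..n}. V i j) \<subseteq> A \<and> \<not> (\<Union>j\<in>{0..n}. V i j) \<subseteq> B"
      using *(3,4) unfolding P_def row_def by blast
    have fin0: "\<forall>i\<in>{1..n}. finite (V i 0)" using fin by simp
    have border: "\<forall>j\<in>{1..n}. \<forall>i\<in>{1..n}. \<forall>k\<in>{1..n}.
        (\<exists>u\<in>V k 0. \<exists>v\<in>V i j. (u, v) \<in> parcs G) \<longrightarrow> i \<le> k"
      using assms(10) unfolding with_proj_simps(3) by meson
    have inner: "\<forall>j\<in>{1..n}. \<forall>i\<in>{1..n}. \<forall>l\<in>{1..n}. \<forall>k\<in>{1..n}.
        (\<exists>u\<in>V i j. \<exists>v\<in>V k l. (u, v) \<in> parcs G) \<longrightarrow> \<bar>int k - int i\<bar> \<le> int m"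
      using assms(12) unfolding with_proj_simps(3) by meson
    \<comment> \<open>Transposing \<open>V\<close> turns rows into columns and \<open>V i 0\<close>
      into the border cell \<open>W 0 i\<close>.\<close>
    show ?thesis
      by (rule columns_need_labels[where W = "\<lambda>i j. V j i",
            OF assms(2) n1 fin0 assms(5,8) border inner *(1) meets notsub *(5,6)])
  qed
  \<comment> \<open>Since \<open>n \<ge> 1\<close>, natural and real subtraction agree, and the
    floor becomes a natural-number quotient.\<close>
  moreover have "\<lfloor>(real n - 1) / (real m + 1)\<rfloor> = int ((n - 1) div (m + 1))"
  proof -
    have "(real n - 1) / (real m + 1) = real (n - 1) / real (m + 1)"
      using n by (simp add: of_nat_diff)
    then show ?thesis by (simp only: floor_divide_of_nat_eq)
  qed
  ultimately show ?thesis by linarith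
qed

end
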